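(* Let $l\in\mathbb{N}=\{1,2,\dots\}$ and let $T$ be a closed operator in a complex uniformly convex (complex) Banach space $\mathcal{X}$. If there exist a non-empty open subset $U\subset\rho(T)$ and a constant $M>0$ such that $$\|(T-\lambda)^{-l}\|=M\quad\text{for all }\lambda\in U,$$ then $\|(T-\lambda)^{-l}\|\geq M$ for all $\lambda\in\rho(T)$.
   Context: $\rho(T)$ denotes the resolvent set of $T$, and $(T-\lambda)^{-l}:=((T-\lambda)^{-1})^l$. A complex normed space $\mathcal{X}$ is called complex uniformly convex if for every $\varepsilon>0$ there exists $\delta>0$ such that for all $x,y\in\mathcal{X}$: if $\|x+\zeta y\|\leq1$ for all $\zeta\in\mathbb{C}$ with $|\zeta|<1$, and $\|y\|>\varepsilon$, then $\|x\|<1-\delta$. *)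

theory Defs
  imports "HOL-Analysis.Analysis"
begin

section \<open>Complex normed spaces\<close>

class complex_normed_vector = real_normed_vector +
  fixes scaleC :: "complex \<Rightarrow> 'a \<Rightarrow> 'a" (infixr \<open>*\<^sub>C\<close> 75)
  assumes scaleC_add_right: "a *\<^sub>C (x + y) = a *\<^sub>C x + a *\<^sub>C y"
    and scaleC_add_left: "(a + b) *\<^sub>C x = a *\<^sub>C x + b *\<^sub>C x"
    and scaleC_scaleC: "a *\<^sub>C b *\<^sub>C x = (a * b) *\<^sub>C x"
    and scaleC_of_real: "complex_of_real r *\<^sub>C x = r *\<^sub>R x"
    and norm_scaleC: "norm (a *\<^sub>C x) = cmod a * norm x"

class complex_banach = complex_normed_vector + banach

lemma vector_space_scaleC:
  "vector_space (scaleC :: complex \<Rightarrow> 'a \<Rightarrow> 'a::complex_normed_vector)"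
proof
  show "1 *\<^sub>C x = x" for x :: 'a
    using scaleC_of_real[of 1 x] by simp
qed (simp_all add: scaleC_add_right scaleC_add_left scaleC_scaleC)

instantiation complex :: complex_banach
begin

definition scaleC_complex :: "complex \<Rightarrow> complex \<Rightarrow> complex"
  where "scaleC_complex a x = a * x"

instance
  by standard (simp_all add: scaleC_complex_def algebra_simps norm_mult scaleR_conv_of_real)

end

definition complex_uniformly_convex :: "'a::complex_normed_vector itself \<Rightarrow> bool"
  where "complex_uniformly_convex _ \<longleftrightarrow>
    (\<forall>\<epsilon>>0. \<exists>\<delta>>0. \<forall>x y :: 'a.
      (\<forall>\<zeta>. cmod \<zeta> < 1 \<longrightarrow> norm (x + \<zeta> *\<^sub>C y) \<le> 1) \<and> norm y > \<epsilon> \<longrightarrow> norm x < 1 - \<delta>)"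

section \<open>Closed operators and their resolvents\<close>

text \<open>
  An operator in a space is given by its domain \<open>D\<close>, a complex linear subspace that need
  not be dense, and a total function \<open>T\<close> whose values outside \<open>D\<close> are irrelevant.
\<close>

definition closed_operator :: "'a::complex_normed_vector set \<Rightarrow> ('a \<Rightarrow> 'a) \<Rightarrow> bool"
  where "closed_operator D T \<longleftrightarrow>
    module.subspace scaleC D \<and>
    (\<forall>x\<in>D. \<forall>y\<in>D. T (x + y) = T x + T y) \<and>
    (\<forall>a. \<forall>x\<in>D. T (a *\<^sub>C x) = a *\<^sub>C T x) \<and>
    closed ((\<lambda>x. (x, T x)) ` D)"

definition resolvent ::
    "'a::complex_normed_vector set \<Rightarrow> ('a \<Rightarrow> 'a) \<Rightarrow> complex \<Rightarrow> 'a \<Rightarrow> 'a"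
  where "resolvent D T z = inv_into D (\<lambda>x. T x - z *\<^sub>C x)"

text \<open>
  The predicate \<open>bounded_linear\<close> speaks about real linearity; for a linear \<open>T\<close>, complex
  linearity of the inverse is automatic.
\<close>

definition resolvent_set ::
    "'a::complex_normed_vector set \<Rightarrow> ('a \<Rightarrow> 'a) \<Rightarrow> complex set"
  where "resolvent_set D T =
    {z. bij_betw (\<lambda>x. T x - z *\<^sub>C x) D UNIV \<and> bounded_linear (resolvent D T z)}"

end

theory Submission
  imports Defs
begin

text \<open>
  Fix \<open>w \<in> U\<close>, write \<open>B\<close> for the resolvent at \<open>w\<close>, and let \<open>x\<close> be a unit vector for which
  \<open>B\<^sup>l x\<close> has norm close to \<open>M\<close>. The vector function \<open>h \<mapsto> (T - w - h)\<^sup>-\<^sup>l x\<close> is bounded by \<open>M\<close> near \<open>0\<close>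
  and has the Taylor coefficients \<open>c\<^sub>0 = B\<^sup>l x\<close> and \<open>c\<^sub>1 = l B\<^sup>l\<^sup>+\<^sup>1 x\<close>. Averaging it against the
  positive kernel \<open>1 + cos\<close> gives \<open>\<parallel>c\<^sub>0 + \<zeta> r c\<^sub>1 / 2\<parallel> \<le> M\<close> for \<open>\<bar>\<zeta>\<bar> \<le> 1\<close>, so complex uniform convexity
  makes \<open>B\<^sup>l\<^sup>+\<^sup>1 x\<close> small. If \<open>R\<close> is the resolvent at an arbitrary \<open>z\<close>, then
  \<open>R\<^sup>l x - B\<^sup>l x = (S\<^sup>l - 1) B\<^sup>l x\<close> with \<open>S = 1 + (z - w) R\<close>, and this is at most a constant times
  \<open>\<parallel>B\<^sup>l\<^sup>+\<^sup>1 x\<parallel>\<close>. Hence \<open>\<parallel>R\<^sup>l\<parallel>\<close> is at least almost \<open>M\<close>.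
\<close>

section \<open>Complex scalar multiplication\<close>

interpretation scaleC: vector_space "scaleC :: complex \<Rightarrow> 'a \<Rightarrow> 'a::complex_normed_vector"
  by (rule vector_space_scaleC)

lemma scaleC_scaleR:
  fixes x :: "'a::complex_normed_vector"
  shows "a *\<^sub>C r *\<^sub>R x = r *\<^sub>R a *\<^sub>C x"
  by (simp flip: scaleC_of_real add: scaleC_scaleC mult.commute)

lemma bounded_linear_scaleC: "bounded_linear (\<lambda>x::'a::complex_normed_vector. a *\<^sub>C x)"
  by (rule bounded_linear_intro[where K = "cmod a"])
    (simp_all add: scaleC_add_right scaleC_scaleR norm_scaleC)

section \<open>Averaging over roots of unity\<close>

lemma sum_powers_root_of_unity:
  fixes u :: complex
  assumes "u ^ N = 1" "u \<noteq> 1"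
  shows "(\<Sum>j<N. u ^ j) = 0"
  using assms by (simp add: geometric_sum)

lemma cis_root_of_unity_power_neq_1:
  assumes "0 < m" "m < N"
  shows "cis (2 * pi / real N) ^ m \<noteq> 1"
proof -
  have inj: "inj_on (\<lambda>k. cis (2 * pi * real k / real N)) {..<N}"
    using Complex.bij_betw_roots_unity[of N] assms by (auto simp: bij_betw_def)
  have "cis (2 * pi * real m / real N) \<noteq> cis (2 * pi * real 0 / real N)"
    using inj_onD[OF inj, of m 0] assms by auto
  then show ?thesis
    unfolding Complex.DeMoivre by (simp add: mult_ac)
qed

lemma norm_fejer_mean_le:
  fixes c :: "nat \<Rightarrow> 'a::complex_normed_vector"
  assumes bound: "\<And>z. cmod z \<le> 1 \<Longrightarrow> norm (\<Sum>k<n. z ^ k *\<^sub>C c k) \<le> K"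
    and n: "2 \<le> n" and \<zeta>: "cmod \<zeta> \<le> 1"
  shows "norm (c 0 + (\<zeta> / 2) *\<^sub>C c 1) \<le> K"
proof -
  define N where "N = Suc n"
  define \<omega> where "\<omega> = cis (2 * pi / real N)"
  have N: "N \<ge> 3" using n by (simp add: N_def)
  have \<omega>N: "\<omega> ^ N = 1"
    unfolding \<omega>_def Complex.DeMoivre using N by simp
  have norm\<omega>: "cmod (\<omega> ^ j) = 1" for j
    by (simp add: \<omega>_def norm_power)
  have \<omega>neq: "\<omega> ^ m \<noteq> 1" if "0 < m" "m < N" for m
    using cis_root_of_unity_power_neq_1[OF that] by (simp add: \<omega>_def)
  have zero: "(\<Sum>j<N. (\<omega> ^ m) ^ j) = 0" if "0 < m" "m < N" for m
    using that \<omega>neq by (intro sum_powers_root_of_unity) (simp_all add: \<omega>N power_mult[symmetric] mult.commute[of m] power_mult[of _ N])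
  have zero_cnj: "(\<Sum>j<N. (cnj \<omega>) ^ j) = 0"
    using arg_cong[OF zero[of 1], of cnj] N by simp
  \<comment> \<open>A discrete kernel \<open>1 + cos\<close>: it is positive with mean 1, its first Fourier coefficient is
    \<open>1/2\<close>, and with \<open>N = n + 1\<close> nodes no aliasing occurs below degree \<open>n\<close>.\<close>
  define w where "w j = (1 + Re (\<omega> ^ j)) / N" for j
  have w_nonneg: "w j \<ge> 0" for j
  proof -
    have "\<bar>Re (\<omega> ^ j)\<bar> \<le> 1"
      using abs_Re_le_cmod[of "\<omega> ^ j"] norm\<omega> by simp
    then show ?thesis by (simp add: w_def)
  qed
  have w_eq: "complex_of_real (w j) = (1 + \<omega> ^ j / 2 + cnj \<omega> ^ j / 2) / N" for j
    by (simp add: w_def complex_eq_iff flip: complex_cnj_power)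
  have \<omega>cnj: "\<omega> * cnj \<omega> = 1"
    by (simp add: \<omega>_def cis_cnj cis_mult)
  define a where "a k = (\<Sum>j<N. of_real (w j) * (\<omega> ^ j) ^ k)" for k
  have a_eq: "a k = ((\<Sum>j<N. (\<omega> ^ k) ^ j) + (\<Sum>j<N. (\<omega> ^ Suc k) ^ j) / 2
      + (\<Sum>j<N. (cnj \<omega> * \<omega> ^ k) ^ j) / 2) / N" for k
    unfolding a_def w_eq
    by (simp add: sum.distrib[symmetric] sum_divide_distrib field_simps power_mult_distrib
        power_mult[symmetric] power_add[symmetric])
  have a0: "a 0 = 1"
    using zero[of 1] zero_cnj N by (simp add: a_eq)
  \<comment> \<open>Only the conjugate term survives, since its ratio is
    \<open>cnj \<omega> * \<omega> = 1\<close>; the ratios \<open>\<omega>\<close> and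
    \<open>\<omega> ^ 2\<close> differ from 1 because \<open>N\<close> is at least 3.\<close>
  have a1: "a 1 = 1 / 2"
    using zero[of 1] zero[of 2] N \<omega>cnj
    by (simp add: a_eq power2_eq_square mult.commute)
  have a_ge2: "a (Suc (Suc k)) = 0" if "Suc (Suc k) < n" for k
  proof -
    have "cnj \<omega> * \<omega> ^ Suc (Suc k) = \<omega> ^ Suc k"
      by (metis \<omega>cnj mult.assoc mult.commute mult_1 power_Suc)
    then show ?thesis
      unfolding a_eq using zero[of "Suc k"] zero[of "Suc (Suc k)"] zero[of "Suc (Suc (Suc k))"] that
      by (simp add: N_def del: power_Suc)
  qed
  have w_sum: "(\<Sum>j<N. w j) = 1"
  proof -
    have "complex_of_real (\<Sum>j<N. w j) = a 0" by (simp add: a_def)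
    then show ?thesis using a0 of_real_eq_1_iff by metis
  qed
  define P where "P z = (\<Sum>k<n. z ^ k *\<^sub>C c k)" for z
  have "(\<Sum>j<N. w j *\<^sub>R P (\<zeta> * \<omega> ^ j)) = (\<Sum>k<n. (a k * \<zeta> ^ k) *\<^sub>C c k)"
  proof -
    have "(\<Sum>j<N. w j *\<^sub>R P (\<zeta> * \<omega> ^ j)) =
        (\<Sum>j<N. \<Sum>k<n. (of_real (w j) * (\<omega> ^ j) ^ k * \<zeta> ^ k) *\<^sub>C c k)"
      by (simp add: P_def scaleC.scale_sum_right scaleC_scaleC mult_ac power_mult_distrib
          flip: scaleC_of_real)
    also have "\<dots> = (\<Sum>k<n. \<Sum>j<N. (of_real (w j) * (\<omega> ^ j) ^ k * \<zeta> ^ k) *\<^sub>C c k)"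
      by (rule sum.swap)
    also have "\<dots> = (\<Sum>k<n. (a k * \<zeta> ^ k) *\<^sub>C c k)"
      by (simp add: a_def sum_distrib_right scaleC.scale_sum_left)
    finally show ?thesis .
  qed
  also have "\<dots> = (\<Sum>k<2. (a k * \<zeta> ^ k) *\<^sub>C c k)"
  proof (rule sum.mono_neutral_right)
    show "\<forall>i\<in>{..<n} - {..<2}. (a i * \<zeta> ^ i) *\<^sub>C c i = 0"
    proof
      fix i assume i: "i \<in> {..<n} - {..<2}"
      then obtain k where "i = Suc (Suc k)"
        by (metis DiffD2 One_nat_def Suc_1 lessThan_iff less_Suc_eq_0_disj not_less_eq not0_implies_Suc)
      with i a_ge2[of k] show "(a i * \<zeta> ^ i) *\<^sub>C c i = 0" by simp
    qed
  qed (use n in auto)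
  also have "\<dots> = c 0 + (\<zeta> / 2) *\<^sub>C c 1"
    using a0 a1 by (simp add: numeral_2_eq_2)
  finally have "norm (c 0 + (\<zeta> / 2) *\<^sub>C c 1) = norm (\<Sum>j<N. w j *\<^sub>R P (\<zeta> * \<omega> ^ j))"
    by simp
  also have "\<dots> \<le> (\<Sum>j<N. w j * K)"
  proof (rule sum_norm_le)
    fix j
    have "norm (P (\<zeta> * \<omega> ^ j)) \<le> K"
      unfolding P_def by (rule bound) (simp add: norm_mult norm\<omega> \<zeta>)
    then show "norm (w j *\<^sub>R P (\<zeta> * \<omega> ^ j)) \<le> w j * K"
      using w_nonneg[of j] by (simp add: mult_left_mono)
  qed
  also have "\<dots> = K" using w_sum by (simp flip: sum_distrib_right)
  finally show ?thesis .
qed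

text \<open>Reduction to polynomials: for \<open>cmod z \<le> r\<close> the tails are dominated
  uniformly by those of the summable majorant, so a long partial sum exceeds the bound by at most
  \<open>e\<close>. The powers of \<open>r\<close> rescale the disc to the unit disc.\<close>

lemma norm_power_series_fejer_mean_le:
  fixes c :: "nat \<Rightarrow> 'a::complex_banach"
  assumes summable: "summable (\<lambda>k. r ^ k * norm (c k))" and r: "0 \<le> r"
    and bound: "\<And>z. cmod z \<le> r \<Longrightarrow> norm (\<Sum>k. z ^ k *\<^sub>C c k) \<le> M"
    and \<zeta>: "cmod \<zeta> \<le> 1"
  shows "norm (c 0 + (\<zeta> * of_real r / 2) *\<^sub>C c 1) \<le> M"
proof (rule field_le_epsilon)
  fix e :: real assume "0 < e"
  obtain N where N: "\<And>n. n \<ge> N \<Longrightarrow> norm (\<Sum>k. r ^ (k + n) * norm (c (k + n))) < e"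
    using suminf_exist_split[OF \<open>0 < e\<close> summable] by blast
  define n where "n = max N 2"
  have poly: "norm (\<Sum>k<n. z ^ k *\<^sub>C (of_real r ^ k *\<^sub>C c k)) \<le> M + e" if z: "cmod z \<le> 1" for z
  proof -
    define u where "u = z * of_real r"
    have u: "cmod u \<le> r"
      using mult_right_mono[OF z r] r by (simp add: u_def norm_mult)
    have le: "norm (u ^ k *\<^sub>C c k) \<le> r ^ k * norm (c k)" for k
      using u by (simp add: norm_scaleC norm_power mult_right_mono power_mono)
    have abs_summable: "summable (\<lambda>k. norm (u ^ k *\<^sub>C c k))"
      by (rule summable_comparison_test'[OF summable, where N = 0]) (simp add: le)
    have tail_norm: "summable (\<lambda>k. norm (u ^ (k + n) *\<^sub>C c (k + n)))"
      using summable_ignore_initial_segment[OF abs_summable, of n] .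
    have "norm (\<Sum>k. u ^ (k + n) *\<^sub>C c (k + n)) \<le> (\<Sum>k. norm (u ^ (k + n) *\<^sub>C c (k + n)))"
      by (rule summable_norm[OF tail_norm])
    also have "\<dots> \<le> (\<Sum>k. r ^ (k + n) * norm (c (k + n)))"
      by (rule suminf_le[OF le tail_norm summable_ignore_initial_segment[OF summable]])
    also have "\<dots> < e"
      using N[of n] by (simp add: n_def)
    finally have tail: "norm (\<Sum>k. u ^ (k + n) *\<^sub>C c (k + n)) < e" .
    have "(\<Sum>k<n. u ^ k *\<^sub>C c k) = (\<Sum>k. u ^ k *\<^sub>C c k) - (\<Sum>k. u ^ (k + n) *\<^sub>C c (k + n))"
      using suminf_split_initial_segment[OF summable_norm_cancel[OF abs_summable], of n] by simp
    then have "norm (\<Sum>k<n. u ^ k *\<^sub>C c k) \<le> M + e"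
      using bound[OF u] tail norm_triangle_ineq4[of "\<Sum>k. u ^ k *\<^sub>C c k"
          "\<Sum>k. u ^ (k + n) *\<^sub>C c (k + n)"] by simp
    then show ?thesis
      by (simp add: u_def scaleC_scaleC power_mult_distrib)
  qed
  show "norm (c 0 + (\<zeta> * of_real r / 2) *\<^sub>C c 1) \<le> M + e"
    using norm_fejer_mean_le[OF poly _ \<zeta>] by (simp add: n_def scaleC_scaleC mult.assoc)
qed


text \<open>The threshold \<open>K\<close> is the same for all sequences \<open>c\<close>, so it can
  be fixed before a vector and its Taylor coefficients are chosen.\<close>

lemma complex_uniformly_convex_power_series:
  assumes "complex_uniformly_convex TYPE('a::complex_banach)"
    and "0 < r" "0 < M" "0 < \<eta>"
  obtains K where "K < M"
    and "\<And>c :: nat \<Rightarrow> 'a. summable (\<lambda>k. r ^ k * norm (c k)) \<Longrightarrow>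
      (\<And>z. cmod z \<le> r \<Longrightarrow> norm (\<Sum>k. z ^ k *\<^sub>C c k) \<le> M) \<Longrightarrow>
      K < norm (c 0) \<Longrightarrow> norm (c 1) \<le> \<eta>"
proof -
  \<comment> \<open>The value of \<open>norm y\<close> for the \<open>y\<close> below when
    \<open>norm (c 1) = \<eta>\<close>; dividing by \<open>M\<close> normalizes the bound to
    1.\<close>
  define \<epsilon> where "\<epsilon> = \<eta> * r / (2 * M)"
  have "\<epsilon> > 0" using assms by (simp add: \<epsilon>_def)
  then obtain \<delta> where "\<delta> > 0" and \<delta>: "\<And>x y :: 'a.
      (\<And>\<zeta>. cmod \<zeta> < 1 \<Longrightarrow> norm (x + \<zeta> *\<^sub>C y) \<le> 1) \<Longrightarrow> norm y > \<epsilon> \<Longrightarrow> norm x < 1 - \<delta>"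
    using assms(1) unfolding complex_uniformly_convex_def by meson
  have "norm (c 1) \<le> \<eta>"
    if c: "summable (\<lambda>k. r ^ k * norm (c k))"
      "\<And>z. cmod z \<le> r \<Longrightarrow> norm (\<Sum>k. z ^ k *\<^sub>C c k) \<le> M" "M * (1 - \<delta>) < norm (c 0)"
    for c :: "nat \<Rightarrow> 'a"
  proof (rule ccontr)
    assume "\<not> norm (c 1) \<le> \<eta>"
    define x where "x = of_real (1 / M) *\<^sub>C c 0"
    define y where "y = of_real (r / (2 * M)) *\<^sub>C c 1"
    have "norm (x + \<zeta> *\<^sub>C y) \<le> 1" if "cmod \<zeta> < 1" for \<zeta>
    proof -
      have "x + \<zeta> *\<^sub>C y = of_real (1 / M) *\<^sub>C (c 0 + (\<zeta> * of_real r / 2) *\<^sub>C c 1)"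
        by (simp add: x_def y_def scaleC_add_right scaleC_scaleC mult_ac)
      moreover have "norm (c 0 + (\<zeta> * of_real r / 2) *\<^sub>C c 1) \<le> M"
        using c assms that by (intro norm_power_series_fejer_mean_le) auto
      ultimately show ?thesis
        using assms by (simp add: norm_scaleC norm_divide)
    qed
    moreover have "norm y > \<epsilon>"
      using \<open>\<not> norm (c 1) \<le> \<eta>\<close> assms
      by (simp add: y_def \<epsilon>_def norm_scaleC norm_divide norm_mult field_simps)
    ultimately have "norm x < 1 - \<delta>" by (rule \<delta>)
    then show False
      using c(3) assms by (simp add: x_def norm_scaleC norm_divide field_simps)
  qed
  then show ?thesis
    using that[of "M * (1 - \<delta>)"] \<open>\<delta> > 0\<close> \<open>0 < M\<close> by simp
qed

section \<open>Powers of operators\<close>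

lemma bounded_linear_funpow:
  fixes f :: "'a::real_normed_vector \<Rightarrow> 'a"
  assumes "bounded_linear f"
  shows "bounded_linear (f ^^ n)"
proof (induction n)
  case (Suc n)
  then show ?case
    using bounded_linear_compose[OF assms] by (simp add: o_def)
qed (simp add: id_def)

lemma norm_funpow_le:
  fixes f :: "'a::real_normed_vector \<Rightarrow> 'a"
  assumes f: "bounded_linear f"
  shows "norm ((f ^^ n) x) \<le> onorm f ^ n * norm x"
proof (induction n)
  case (Suc n)
  have "norm ((f ^^ Suc n) x) \<le> onorm f * norm ((f ^^ n) x)"
    using onorm[OF f] by simp
  also have "\<dots> \<le> onorm f * (onorm f ^ n * norm x)"
    using Suc onorm_pos_le[OF f] by (rule mult_left_mono)
  finally show ?case by (simp add: mult.assoc)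
qed simp

lemma funpow_commute:
  assumes "\<And>x. f (g x) = g (f x)"
  shows "(f ^^ n) (g x) = g ((f ^^ n) x)"
  by (induction n) (simp_all add: assms)

lemma funpow_compose_commute:
  assumes "\<And>x. f (g x) = g (f x)"
  shows "((\<lambda>x. f (g x)) ^^ n) x = (f ^^ n) ((g ^^ n) x)"
  by (induction n) (simp_all add: assms funpow_commute[of f g])

lemma exists_unit_vector_norm_gt:
  fixes f :: "'a::real_normed_vector \<Rightarrow> 'b::real_normed_vector"
  assumes f: "bounded_linear f" and K: "0 \<le> K" "K < onorm f"
  obtains x where "norm x = 1" "K < norm (f x)"
proof -
  obtain x where x: "K * norm x < norm (f x)"
    using onorm_bound[of K f] K by (meson not_le)
  have "x \<noteq> 0" using x linear_simps(3)[OF f] by auto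
  show ?thesis
  proof
    show "norm (x /\<^sub>R norm x) = 1" using \<open>x \<noteq> 0\<close> by simp
    show "K < norm (f (x /\<^sub>R norm x))"
      using x \<open>x \<noteq> 0\<close> by (simp add: linear_simps[OF f] field_simps)
  qed
qed

section \<open>The power series of a power of the resolvent\<close>

text \<open>For positive \<open>l\<close> this is the binomial series of \<open>1 - t\<close> to the
  power \<open>-l\<close>, after the sign reflection of generalized binomial coefficients.\<close>

lemma summable_binomial_power:
  fixes t :: real
  assumes "0 \<le> t" "t < 1"
  shows "summable (\<lambda>k. real (k + l - 1 choose k) * t ^ k)"
proof (cases l)
  case 0
  have "real (k + l - 1 choose k) * t ^ k = 0" if "k \<notin> {0}" for k
    using that 0 by (simp add: binomial_eq_0)
  then show ?thesis
    by (intro summable_finite[of "{0}"]) auto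
next
  case (Suc m)
  have "(- real l gchoose k) * (- t) ^ k = real (k + l - 1 choose k) * t ^ k" for k
  proof -
    have "(- real l gchoose k) = (- 1) ^ k * (real (k + m) gchoose k)"
      using gbinomial_minus[of "real l" k] by (simp add: Suc add_ac)
    moreover have "(- 1) ^ k * (- t) ^ k = t ^ k"
      by (simp flip: power_mult_distrib)
    ultimately show ?thesis
      by (simp add: Suc binomial_gbinomial mult.commute mult.left_commute)
  qed
  then show ?thesis
    using gen_binomial_real[of "- t" "- real l"] assms by (simp add: sums_iff)
qed

text \<open>For \<open>l = 0\<close> truncated subtraction makes all coefficients but the zeroth vanish.\<close>

definition resolvent_coeff ::
    "('a::complex_normed_vector \<Rightarrow> 'a) \<Rightarrow> nat \<Rightarrow> 'a \<Rightarrow> nat \<Rightarrow> 'a"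
  where "resolvent_coeff B l x k = of_nat (k + l - 1 choose k) *\<^sub>C (B ^^ (k + l)) x"

text \<open>Bounding powers of \<open>B\<close> by powers of its norm leaves the binomial series at
  \<open>r * onorm B\<close>, times a constant.\<close>

lemma summable_resolvent_coeff:
  assumes B: "bounded_linear B" and r: "0 \<le> r" "r * onorm B < 1"
  shows "summable (\<lambda>k. r ^ k * norm (resolvent_coeff B l x k))"
proof -
  define b where "b = onorm B"
  have b: "b \<ge> 0" using onorm_pos_le[OF B] by (simp add: b_def)
  have "summable (\<lambda>k. real (k + l - 1 choose k) * (r * b) ^ k * (b ^ l * norm x))"
    using r b by (intro summable_mult2 summable_binomial_power) (simp_all add: b_def)
  then show ?thesis
  proof (rule summable_comparison_test'[where N = 0])
    fix k
    have "r ^ k * norm (resolvent_coeff B l x k)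
        = r ^ k * real (k + l - 1 choose k) * norm ((B ^^ (k + l)) x)"
      by (simp add: resolvent_coeff_def norm_scaleC)
    also have "\<dots> \<le> r ^ k * real (k + l - 1 choose k) * (b ^ (k + l) * norm x)"
      using norm_funpow_le[OF B, of "k + l" x] r by (intro mult_left_mono) (simp_all add: b_def)
    finally show "norm (r ^ k * norm (resolvent_coeff B l x k))
        \<le> real (k + l - 1 choose k) * (r * b) ^ k * (b ^ l * norm x)"
      using r by (simp add: power_mult_distrib power_add mult_ac)
  qed
qed

text \<open>
  The hypotheses on \<open>R\<close> say that it is a two-sided form of \<open>B (1 - h B)\<^sup>-\<^sup>1\<close>. Writing \<open>G\<^sub>l\<close> for the sum
  of the series, Pascal's rule gives \<open>(1 - h B) G\<^sub>l\<^sub>+\<^sub>1 = B G\<^sub>l\<close>, and \<open>1 - h B\<close> is injective.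
\<close>

lemma resolvent_power_sums:
  fixes B R :: "'a::complex_banach \<Rightarrow> 'a"
  assumes B: "bounded_linear B" and R: "bounded_linear R"
    and BC: "\<And>a x. B (a *\<^sub>C x) = a *\<^sub>C B x"
    and RB: "\<And>y. R (y - h *\<^sub>C B y) = B y"
    and BR: "\<And>y. R y - h *\<^sub>C B (R y) = B y"
    and h: "cmod h * onorm B < 1"
  shows "(\<lambda>k. h ^ k *\<^sub>C resolvent_coeff B l x k) sums (R ^^ l) x"
proof (induction l)
  case 0
  have "(\<lambda>k. h ^ k *\<^sub>C resolvent_coeff B 0 x k) = (\<lambda>k. if k = 0 then x else 0)"
    by (auto simp: resolvent_coeff_def fun_eq_iff)
  then show ?case using sums_single[of 0 "\<lambda>_. x"] by (simp add: eq_commute)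
next
  case (Suc l)
  interpret B: bounded_linear B by fact
  define g where "g l k = h ^ k *\<^sub>C resolvent_coeff B l x k" for l k
  define S where "S = suminf (g (Suc l))"
  have "summable (\<lambda>k. norm (g (Suc l) k))"
    using summable_resolvent_coeff[OF B _ h] by (simp add: g_def norm_scaleC norm_power)
  then have gS: "g (Suc l) sums S"
    unfolding S_def by (rule summable_sums[OF summable_norm_cancel])
  have hB: "bounded_linear (\<lambda>x. h *\<^sub>C B x)"
    by (rule bounded_linear_compose[OF bounded_linear_scaleC B])
  have Bg: "(\<lambda>k. B (g l k)) sums B ((R ^^ l) x)"
    using B.sums Suc by (simp add: g_def)
  have "(\<lambda>k. g (Suc l) (Suc k)) sums (S - g (Suc l) 0)"
    using gS by (simp add: sums_Suc_iff)
  then have "(\<lambda>k. g (Suc l) (Suc k) - h *\<^sub>C B (g (Suc l) k)) sums (S - g (Suc l) 0 - h *\<^sub>C B S)"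
    by (intro sums_diff bounded_linear.sums[OF hB] gS)
  moreover have "g (Suc l) (Suc k) - h *\<^sub>C B (g (Suc l) k) = B (g l (Suc k))" for k
  proof -
    define X where "X = (B ^^ Suc (Suc (k + l))) x"
    have "g (Suc l) (Suc k) = (h ^ Suc k * of_nat (Suc (k + l) choose Suc k)) *\<^sub>C X"
      and "h *\<^sub>C B (g (Suc l) k) = (h ^ Suc k * of_nat (k + l choose k)) *\<^sub>C X"
      and "B (g l (Suc k)) = (h ^ Suc k * of_nat (k + l choose Suc k)) *\<^sub>C X"
      by (simp_all add: g_def resolvent_coeff_def X_def BC scaleC_scaleC mult.assoc
          del: binomial_Suc_Suc)
    then show ?thesis
      by (simp add: ring_distribs scaleC_add_left)
  qed
  moreover have "g (Suc l) 0 = B (g l 0)"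
    by (simp add: g_def resolvent_coeff_def BC)
  ultimately have "(\<lambda>k. B (g l (Suc k))) sums (S - h *\<^sub>C B S - B (g l 0))"
    by (simp add: algebra_simps)
  then have "(\<lambda>k. B (g l k)) sums (S - h *\<^sub>C B S)"
    by (subst (asm) sums_Suc_iff) simp
  with Bg have S: "S - h *\<^sub>C B S = B ((R ^^ l) x)"
    by (rule sums_unique2[symmetric])
  \<comment> \<open>Injectivity of \<open>1 - h B\<close>: if it maps \<open>v\<close> to 0, then
    \<open>RB\<close> gives \<open>B v = R 0 = 0\<close>, and so
    \<open>v = h B v = 0\<close>.\<close>
  define v where "v = S - R ((R ^^ l) x)"
  have "v - h *\<^sub>C B v
      = (S - h *\<^sub>C B S) - (R ((R ^^ l) x) - h *\<^sub>C B (R ((R ^^ l) x)))"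
    by (simp add: v_def B.diff scaleC.scale_right_diff_distrib)
  also have "\<dots> = 0" unfolding S BR by simp
  finally have v: "v - h *\<^sub>C B v = 0" .
  then have "B v = 0" using RB[of v] linear_simps(3)[OF R] by simp
  then have "v = 0" using v by simp
  then show ?case using gS by (simp add: v_def g_def[abs_def])
qed

text \<open>Induction on \<open>n\<close>, splitting off \<open>S y - y\<close>, which is itself
  controlled by \<open>B y\<close>. What matters is that \<open>C\<close> does not depend on
  \<open>y\<close>.\<close>

lemma resolvent_power_perturbation:
  assumes S: "bounded_linear S" and SB: "\<And>y. S y - y = \<mu> *\<^sub>C S (B y)"
  obtains C where "C \<ge> 0" "\<And>y::'a::complex_normed_vector. norm ((S ^^ n) y - y) \<le> C * norm (B y)"
proof -
  have "\<exists>C\<ge>0. \<forall>y. norm ((S ^^ n) y - y) \<le> C * norm (B y)"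
  proof (induction n)
    case (Suc n)
    then obtain C where C: "C \<ge> 0" "\<And>y. norm ((S ^^ n) y - y) \<le> C * norm (B y)" by blast
    define s where "s = onorm S"
    have s: "s \<ge> 0" "\<And>y. norm (S y) \<le> s * norm y"
      using onorm_pos_le[OF S] onorm[OF S] by (auto simp: s_def)
    have "norm ((S ^^ Suc n) y - y) \<le> (s * C + cmod \<mu> * s) * norm (B y)" for y
    proof -
      have "(S ^^ Suc n) y - y = S ((S ^^ n) y - y) + \<mu> *\<^sub>C S (B y)"
        using SB[of y] by (simp add: linear_simps[OF S] algebra_simps)
      also have "norm \<dots> \<le> s * (C * norm (B y)) + cmod \<mu> * (s * norm (B y))"
        using s(2)[of "(S ^^ n) y - y"] mult_left_mono[OF C(2) s(1), of y]
          mult_left_mono[OF s(2), of "cmod \<mu>" "B y"]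
        by (intro norm_triangle_mono) (simp_all add: norm_scaleC)
      finally show ?thesis by (simp add: algebra_simps)
    qed
    then show ?case
      using C(1) s(1) by (intro exI[of _ "s * C + cmod \<mu> * s"]) simp
  qed (auto intro: exI[of _ 0])
  then show ?thesis using that by blast
qed

section \<open>Resolvents of an operator\<close>

context
  fixes D :: "'a::complex_normed_vector set" and T :: "'a \<Rightarrow> 'a"
  assumes closed: "closed_operator D T"
begin

lemma bounded_linear_resolvent: "z \<in> resolvent_set D T \<Longrightarrow> bounded_linear (resolvent D T z)"
  by (simp add: resolvent_set_def)

lemma resolvent_in_domain: "z \<in> resolvent_set D T \<Longrightarrow> resolvent D T z y \<in> D"
  unfolding resolvent_set_def resolvent_def bij_betw_def
  by (auto intro!: inv_into_into)

lemma resolvent_right_inverse: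
  assumes "z \<in> resolvent_set D T"
  shows "T (resolvent D T z y) - z *\<^sub>C resolvent D T z y = y"
proof -
  have "y \<in> (\<lambda>x. T x - z *\<^sub>C x) ` D"
    using assms by (auto simp: resolvent_set_def bij_betw_def)
  from f_inv_into_f[OF this] show ?thesis by (simp add: resolvent_def)
qed

lemma resolvent_left_inverse:
  assumes "z \<in> resolvent_set D T" "u \<in> D"
  shows "resolvent D T z (T u - z *\<^sub>C u) = u"
  unfolding resolvent_def
  using assms by (intro inv_into_f_f[of "\<lambda>x. T x - z *\<^sub>C x" D u])
    (auto simp: resolvent_set_def bij_betw_def)

text \<open>\<open>resolvent_set\<close> grants only real linearity; complex homogeneity comes from
  that of \<open>T\<close> on \<open>D\<close> and uniqueness of preimages.\<close>

lemma resolvent_scaleC: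
  assumes z: "z \<in> resolvent_set D T"
  shows "resolvent D T z (a *\<^sub>C y) = a *\<^sub>C resolvent D T z y"
proof -
  define u where "u = resolvent D T z y"
  have u: "u \<in> D" "T u - z *\<^sub>C u = y"
    using resolvent_in_domain resolvent_right_inverse z by (auto simp: u_def)
  have "a *\<^sub>C u \<in> D"
    using closed u by (simp add: closed_operator_def scaleC.subspace_scale)
  moreover have "T (a *\<^sub>C u) - z *\<^sub>C (a *\<^sub>C u) = a *\<^sub>C y"
    using closed u(1) by (simp add: closed_operator_def scaleC_scaleC mult.commute
        scaleC.scale_right_diff_distrib flip: u(2))
  ultimately show ?thesis
    using resolvent_left_inverse[OF z, of "a *\<^sub>C u"] by (simp add: u_def)
qed

text \<open>Apply the resolvent at \<open>z\<close> to \<open>(T - z) u = y + (w - z) u\<close>,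
  where \<open>u\<close> is the resolvent at \<open>w\<close> of \<open>y\<close>.\<close>

lemma resolvent_identity:
  assumes z: "z \<in> resolvent_set D T" and w: "w \<in> resolvent_set D T"
  shows "resolvent D T w y - resolvent D T z y
    = (w - z) *\<^sub>C resolvent D T z (resolvent D T w y)"
proof -
  define u where "u = resolvent D T w y"
  have u: "u \<in> D" "T u - w *\<^sub>C u = y"
    using resolvent_in_domain resolvent_right_inverse w by (auto simp: u_def)
  have "T u - z *\<^sub>C u = y + (w - z) *\<^sub>C u"
    by (simp add: scaleC.scale_left_diff_distrib flip: u(2))
  then have "u = resolvent D T z y + (w - z) *\<^sub>C resolvent D T z u"
    using resolvent_left_inverse[OF z u(1)] resolvent_scaleC[OF z]
      linear_simps(1)[OF bounded_linear_resolvent[OF z]] by metis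
  then show ?thesis by (simp add: u_def algebra_simps)
qed

text \<open>Exchanging \<open>z\<close> and \<open>w\<close> gives the other order of composition;
  both orders are needed for two-sided inverses and for commutation.\<close>

lemma resolvent_identity':
  assumes z: "z \<in> resolvent_set D T" and w: "w \<in> resolvent_set D T"
  shows "resolvent D T w y - resolvent D T z y
    = (w - z) *\<^sub>C resolvent D T w (resolvent D T z y)"
proof -
  have "resolvent D T w y - resolvent D T z y = - ((z - w) *\<^sub>C resolvent D T w (resolvent D T z y))"
    unfolding resolvent_identity[OF w z, symmetric] by simp
  then show ?thesis by (simp flip: scaleC.scale_minus_left)
qed

end

theorem theorem3p4:
  fixes D :: "'a::complex_banach set"
    and T :: "'a \<Rightarrow> 'a"
    and l :: nat and U :: "complex set" and M :: real
  assumes "l \<ge> 1"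
    and "complex_uniformly_convex TYPE('a)"
    and "closed_operator D T"
    and "open U" and "U \<noteq> {}" and "U \<subseteq> resolvent_set D T"
    and "M > 0"
    and "\<forall>z\<in>U. onorm (resolvent D T z ^^ l) = M"
  shows "\<forall>z\<in>resolvent_set D T. onorm (resolvent D T z ^^ l) \<ge> M"
proof
  fix z assume z: "z \<in> resolvent_set D T"
  let ?R = "resolvent D T"
  note cl = \<open>closed_operator D T\<close>
  note bl = bounded_linear_resolvent[OF cl]
  note ident = resolvent_identity[OF cl] and ident' = resolvent_identity'[OF cl]
  obtain w e where w: "w \<in> U" "e > 0" "ball w e \<subseteq> U"
    using assms(4,5) by (metis all_not_in_conv open_contains_ball)
  then have w\<rho>: "w \<in> resolvent_set D T" using assms(6) by blast
  define B where "B = ?R w"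
  have B: "bounded_linear B" and BC: "\<And>a x. B (a *\<^sub>C x) = a *\<^sub>C B x"
    using bl resolvent_scaleC[OF cl] w\<rho> by (auto simp: B_def)
  define b where "b = onorm B"
  have "b \<ge> 0" using onorm_pos_le[OF B] by (simp add: b_def)
  \<comment> \<open>The first bound keeps the closed disc around \<open>w\<close> inside
    \<open>U\<close>, the second makes the series converge; \<open>b + 1\<close> avoids division by
    zero.\<close>
  define r where "r = min (e / 2) (1 / (2 * (b + 1)))"
  have r: "0 < r" "r < e" using w \<open>b \<ge> 0\<close> by (auto simp: r_def min_def)
  have "r * b \<le> 1 / (2 * (b + 1)) * b"
    using \<open>b \<ge> 0\<close> by (intro mult_right_mono) (auto simp: r_def)
  also have "\<dots> < 1" using \<open>b \<ge> 0\<close> by (simp add: field_simps)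
  finally have rb: "r * b < 1" .

  define c where "c x = resolvent_coeff B l x" for x
  have c0: "c x 0 = (B ^^ l) x" and c1: "c x 1 = of_nat l *\<^sub>C B ((B ^^ l) x)" for x
    by (simp_all add: c_def resolvent_coeff_def)
  have c_summable: "summable (\<lambda>k. r ^ k * norm (c x k))" for x
    unfolding c_def using r rb by (intro summable_resolvent_coeff B) (auto simp: b_def)
  have c_bound: "norm (\<Sum>k. h ^ k *\<^sub>C c x k) \<le> M" if h: "cmod h \<le> r" and x: "norm x = 1" for h x
  proof -
    have "w + h \<in> U" using w h r by (auto simp: dist_norm subset_iff)
    then have wh: "w + h \<in> resolvent_set D T" using assms(6) by blast
    have "cmod h * b \<le> r * b" using h \<open>b \<ge> 0\<close> by (rule mult_right_mono)
    then have "cmod h * onorm B < 1" using rb by (simp add: b_def)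
    moreover have "?R (w + h) (y - h *\<^sub>C B y) = B y" for y
    proof -
      have "?R (w + h) (y - h *\<^sub>C B y) = ?R (w + h) y - h *\<^sub>C ?R (w + h) (B y)"
        by (simp only: linear_simps(2)[OF bl[OF wh]] resolvent_scaleC[OF cl wh])
      then show ?thesis
        using ident'[OF w\<rho> wh, of y] by (simp add: B_def algebra_simps)
    qed
    moreover have "?R (w + h) y - h *\<^sub>C B (?R (w + h) y) = B y" for y
      using ident[OF w\<rho> wh, of y] by (simp add: B_def algebra_simps)
    ultimately have "(\<lambda>k. h ^ k *\<^sub>C c x k) sums (?R (w + h) ^^ l) x"
      unfolding c_def using B BC bl[OF wh] by (intro resolvent_power_sums) auto
    then have "(\<Sum>k. h ^ k *\<^sub>C c x k) = (?R (w + h) ^^ l) x" by (rule sums_unique[symmetric])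
    then show ?thesis
      using onorm[OF bounded_linear_funpow[OF bl[OF wh]], of l x] assms(8) \<open>w + h \<in> U\<close> x by simp
  qed

  define \<mu> where "\<mu> = z - w"
  \<comment> \<open>\<open>S\<close> is the bounded operator
    \<open>(T - w) (T - z)\<^sup>-\<^sup>1\<close>. It commutes with \<open>B\<close> and satisfies
    \<open>?R z = S B\<close>, whence the factorization of the \<open>l\<close>-th power.\<close>
  define S where "S y = y + \<mu> *\<^sub>C ?R z y" for y
  have R_SB: "?R z y = S (B y)" for y
    using ident'[OF w\<rho> z, of y] by (simp add: S_def B_def \<mu>_def algebra_simps)
  have R_BS: "?R z y = B (S y)" for y
    using ident[OF w\<rho> z, of y] by (simp add: S_def linear_simps(1)[OF B] BC)
      (simp add: B_def \<mu>_def algebra_simps)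
  have "bounded_linear S"
    unfolding S_def by (intro bounded_linear_add bounded_linear_ident
        bounded_linear_compose[OF bounded_linear_scaleC bl[OF z]])
  moreover have "S y - y = \<mu> *\<^sub>C S (B y)" for y
    using R_SB[of y] by (simp add: S_def)
  ultimately obtain C where C: "C \<ge> 0" "\<And>y. norm ((S ^^ l) y - y) \<le> C * norm (B y)"
    using resolvent_power_perturbation[of S \<mu> B l] by blast
  have Rl: "(?R z ^^ l) x = (S ^^ l) ((B ^^ l) x)" for x
  proof -
    have "?R z = (\<lambda>y. S (B y))" using R_SB by blast
    then show ?thesis
      using funpow_compose_commute[of S B l x] R_SB R_BS by simp
  qed

  show "M \<le> onorm (?R z ^^ l)"
  proof (rule field_le_epsilon)
    fix \<epsilon> :: real assume "\<epsilon> > 0"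
    define \<eta> where "\<eta> = \<epsilon> / (2 * (C + 1))"
    have \<eta>: "\<eta> > 0" "C * \<eta> \<le> \<epsilon> / 2"
      using C(1) \<open>\<epsilon> > 0\<close> by (auto simp: \<eta>_def field_simps)
    obtain K where K: "K < M" "\<And>c :: nat \<Rightarrow> 'a. summable (\<lambda>k. r ^ k * norm (c k)) \<Longrightarrow>
        (\<And>z. cmod z \<le> r \<Longrightarrow> norm (\<Sum>k. z ^ k *\<^sub>C c k) \<le> M) \<Longrightarrow>
        K < norm (c 0) \<Longrightarrow> norm (c 1) \<le> \<eta>"
      using complex_uniformly_convex_power_series[OF assms(2) r(1) assms(7) \<eta>(1)] by blast
    \<comment> \<open>Three demands on \<open>x\<close>: a nonnegative threshold for the choice of a
      unit vector, \<open>K\<close> for uniform convexity, and a loss of at most half of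
      \<open>\<epsilon>\<close>. The other half pays for the perturbation.\<close>
    have "max 0 (max K (M - \<epsilon> / 2)) < onorm (B ^^ l)"
      using assms(7,8) w(1) K(1) \<open>\<epsilon> > 0\<close> by (simp add: B_def)
    then obtain x where x: "norm x = 1" "max 0 (max K (M - \<epsilon> / 2)) < norm ((B ^^ l) x)"
      using exists_unit_vector_norm_gt[OF bounded_linear_funpow[OF B], of _ l] by (metis max.cobounded1)
    have "norm (c x 1) \<le> \<eta>"
      using K(2)[OF c_summable c_bound] x c0 by simp
    then have "real l * norm (B ((B ^^ l) x)) \<le> \<eta>"
      unfolding c1 by (simp add: norm_scaleC)
    \<comment> \<open>Here \<open>l \<ge> 1\<close> lets the factor \<open>l\<close> of the first
      Taylor coefficient be dropped.\<close>
    moreover have "norm (B ((B ^^ l) x)) \<le> real l * norm (B ((B ^^ l) x))"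
      using mult_right_mono[of 1 "real l" "norm (B ((B ^^ l) x))"] assms(1) by simp
    ultimately have "norm (B ((B ^^ l) x)) \<le> \<eta>" by simp
    from mult_left_mono[OF this C(1)]
    have "norm ((?R z ^^ l) x - (B ^^ l) x) \<le> \<epsilon> / 2"
      using C(2)[of "(B ^^ l) x"] \<eta>(2) unfolding Rl by linarith
    moreover have "norm ((B ^^ l) x) \<le> norm ((?R z ^^ l) x) + norm ((?R z ^^ l) x - (B ^^ l) x)"
      by (metis norm_minus_commute norm_triangle_sub)
    moreover have "norm ((?R z ^^ l) x) \<le> onorm (?R z ^^ l)"
      using onorm[OF bounded_linear_funpow[OF bl[OF z]], of l x] x by simp
    ultimately show "M \<le> onorm (?R z ^^ l) + \<epsilon>"
      using x by linarith
  qed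
qed

end
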